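(* Let $M$ be a von Neumann algebra with a faithful normal state $\varphi_\rho$, let $N_t\subseteq M$ be an abelian von Neumann subalgebra, and let $E_t:M\to N_t$ be a normal $\varphi_\rho$-preserving conditional expectation. Then for all $X\in M$, $$\|E_t(X)\|_2\le\|X\|_2\qquad\text{and}\qquad \langle E_t(X),A\rangle_{\varphi_\rho}=\langle X,A\rangle_{\varphi_\rho}\quad\forall A\in N_t .$$ Consequently $E_t$ extends uniquely to a bounded linear operator on $L^2(M,\varphi_\rho)$ of operator norm at most $1$.
   Context: For $X,Y\in M$, $\langle X,Y\rangle_{\varphi_\rho}:=\varphi_\rho(X^*Y)$ and $\|X\|_2:=\varphi_\rho(X^*X)^{1/2}$; $L^2(M,\varphi_\rho)$ is the Hilbert space completion of $M$ in $\|\cdot\|_2$ (faithfulness makes this a norm on $M$). A conditional expectation $E:M\to N$ is a unital completely positive idempotent map onto $N$ that is $N$-bimodular, $E(aXb)=aE(X)b$ for $a,b\in N$; it is $\varphi_\rho$-preserving if $\varphi_\rho\circ E=\varphi_\rho$. *)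

theory Defs
  imports "HOL-Analysis.Analysis" "HOL-Library.Nonpos_Ints"
begin

section \<open>Complex vector spaces and complex Hilbert spaces\<close>

class complex_vector = ab_group_add +
  fixes scaleC :: "complex \<Rightarrow> 'a \<Rightarrow> 'a" (infixr "*\<^sub>C" 75)
  assumes scaleC_add_right: "a *\<^sub>C (x + y) = a *\<^sub>C x + a *\<^sub>C y"
    and scaleC_add_left: "(a + b) *\<^sub>C x = a *\<^sub>C x + b *\<^sub>C x"
    and scaleC_scaleC: "a *\<^sub>C b *\<^sub>C x = (a * b) *\<^sub>C x"
    and scaleC_one: "1 *\<^sub>C x = x"

text \<open>The inner product is conjugate-linear in the first argument. The norm is the one of the
  underlying real inner product space, so that \<open>(norm x)\<^sup>2 = cinner x x\<close>; positive definiteness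
  is inherited from \<^class>\<open>real_inner\<close>.\<close>

class chilbert_space = complex_vector + real_inner + complete_space +
  fixes cinner :: "'a \<Rightarrow> 'a \<Rightarrow> complex"
  assumes scaleR_scaleC: "r *\<^sub>R x = complex_of_real r *\<^sub>C x"
    and cinner_commute: "cinner x y = cnj (cinner y x)"
    and cinner_add_right: "cinner x (y + z) = cinner x y + cinner x z"
    and cinner_scaleC_right: "cinner x (a *\<^sub>C y) = a * cinner x y"
    and inner_eq_Re_cinner: "inner x y = Re (cinner x y)"

instantiation complex :: chilbert_space
begin

definition scaleC_complex :: "complex \<Rightarrow> complex \<Rightarrow> complex"
  where "scaleC_complex a x = a * x"

definition cinner_complex :: "complex \<Rightarrow> complex \<Rightarrow> complex"
  where "cinner_complex x y = cnj x * y"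

instance
  by standard
    (auto simp: scaleC_complex_def cinner_complex_def algebra_simps inner_complex_def
      scaleR_conv_of_real)

end

lemma scaleC_zero_right [simp]: "a *\<^sub>C (0::'a::complex_vector) = 0"
  using scaleC_add_right[of a 0 "0::'a"] by simp

lemma scaleC_minus_right: "a *\<^sub>C (- x) = - (a *\<^sub>C (x::'a::complex_vector))"
  using scaleC_add_right[of a x "- x"] by (simp add: eq_neg_iff_add_eq_0 add.commute)

lemma scaleC_diff_right: "a *\<^sub>C (x - y) = a *\<^sub>C x - a *\<^sub>C (y::'a::complex_vector)"
  using scaleC_add_right[of a x "- y"] by (simp add: scaleC_minus_right)

lemma cinner_self: "cinner x x = complex_of_real ((norm (x::'a::chilbert_space))\<^sup>2)"
proof -
  have "Im (cinner x x) = 0"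
    using arg_cong[OF cinner_commute[of x x], of Im] by simp
  then show ?thesis
    by (simp add: complex_eq_iff power2_norm_eq_inner inner_eq_Re_cinner)
qed

lemma norm_scaleC: "norm (a *\<^sub>C x) = norm a * norm (x::'a::chilbert_space)"
proof -
  have "cinner (a *\<^sub>C x) (a *\<^sub>C x) = a * cnj (cinner x (a *\<^sub>C x))"
    by (metis cinner_commute cinner_scaleC_right)
  also have "\<dots> = a * cnj a * cnj (cinner x x)"
    by (simp add: cinner_scaleC_right)
  also have "\<dots> = complex_of_real ((norm a * norm x)\<^sup>2)"
    by (simp add: cinner_self complex_norm_square[symmetric] power_mult_distrib
        del: of_real_power)
  finally have "complex_of_real ((norm (a *\<^sub>C x))\<^sup>2) = complex_of_real ((norm a * norm x)\<^sup>2)"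
    by (simp only: cinner_self)
  then have "(norm (a *\<^sub>C x))\<^sup>2 = (norm a * norm x)\<^sup>2"
    by (simp only: of_real_eq_iff)
  then show ?thesis
    by (simp add: power2_eq_iff_nonneg)
qed

lemma bounded_linear_scaleC: "bounded_linear (\<lambda>x::'a::chilbert_space. a *\<^sub>C x)"
  by (rule bounded_linear_intro[where K = "norm a"])
    (simp_all add: scaleC_add_right scaleR_scaleC scaleC_scaleC norm_scaleC mult.commute)

definition clinear_on :: "'a::complex_vector set \<Rightarrow> ('a \<Rightarrow> 'b::complex_vector) \<Rightarrow> bool"
  where "clinear_on V f \<longleftrightarrow>
    (\<forall>x\<in>V. \<forall>y\<in>V. f (x + y) = f x + f y) \<and> (\<forall>a. \<forall>x\<in>V. f (a *\<^sub>C x) = a *\<^sub>C f x)"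

definition csubspace :: "'a::complex_vector set \<Rightarrow> bool"
  where "csubspace V \<longleftrightarrow>
    0 \<in> V \<and> (\<forall>x\<in>V. \<forall>y\<in>V. x + y \<in> V) \<and> (\<forall>a. \<forall>x\<in>V. a *\<^sub>C x \<in> V)"

section \<open>Bounded operators on a complex Hilbert space\<close>

typedef (overloaded) 'h bop =
  "{T :: 'h::chilbert_space \<Rightarrow> 'h. bounded_linear T \<and> (\<forall>a x. T (a *\<^sub>C x) = a *\<^sub>C T x)}"
  morphisms bop_apply Bop
  by (rule exI[of _ "\<lambda>x. x"]) simp

setup_lifting type_definition_bop

text \<open>The product is composition. The type is only declared a \<^class>\<open>ring\<close> with unit
  (\<^class>\<open>monoid_mult\<close>), since \<^class>\<open>ring_1\<close> would exclude the zero Hilbert space.\<close>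

instantiation bop :: (chilbert_space) "{ring, monoid_mult, complex_vector}"
begin

lift_definition zero_bop :: "'a bop" is "\<lambda>x. 0"
  by simp

lift_definition one_bop :: "'a bop" is "\<lambda>x. x"
  by simp

lift_definition plus_bop :: "'a bop \<Rightarrow> 'a bop \<Rightarrow> 'a bop" is "\<lambda>S T x. S x + T x"
  by (simp add: bounded_linear_add scaleC_add_right)

lift_definition uminus_bop :: "'a bop \<Rightarrow> 'a bop" is "\<lambda>T x. - T x"
  by (simp add: bounded_linear_minus scaleC_minus_right)

lift_definition minus_bop :: "'a bop \<Rightarrow> 'a bop \<Rightarrow> 'a bop" is "\<lambda>S T x. S x - T x"
  by (simp add: bounded_linear_sub scaleC_diff_right)

lift_definition times_bop :: "'a bop \<Rightarrow> 'a bop \<Rightarrow> 'a bop" is "\<lambda>S T x. S (T x)"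
  by (simp add: bounded_linear_compose)

lift_definition scaleC_bop :: "complex \<Rightarrow> 'a bop \<Rightarrow> 'a bop" is "\<lambda>a T x. a *\<^sub>C T x"
  by (simp add: bounded_linear_compose[OF bounded_linear_scaleC] scaleC_scaleC mult.commute)

instance
proof
  fix R S T :: "'a bop" and a b :: complex
  show "R + S + T = R + (S + T)" by transfer (simp add: add.assoc)
  show "R + S = S + R" by transfer (simp add: add.commute)
  show "0 + R = R" by transfer simp
  show "- R + R = 0" by transfer simp
  show "R - S = R + - S" by transfer simp
  show "R * S * T = R * (S * T)" by transfer simp
  show "(R + S) * T = R * T + S * T" by transfer simp
  show "R * (S + T) = R * S + R * T"
    by transfer (auto simp: linear_simps(1) fun_eq_iff)
  show "1 * R = R" by transfer simp
  show "R * 1 = R" by transfer simp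
  show "a *\<^sub>C (R + S) = a *\<^sub>C R + a *\<^sub>C S" by transfer (simp add: scaleC_add_right)
  show "(a + b) *\<^sub>C R = a *\<^sub>C R + b *\<^sub>C R" by transfer (simp add: scaleC_add_left)
  show "a *\<^sub>C b *\<^sub>C R = (a * b) *\<^sub>C R" by transfer (simp add: scaleC_scaleC)
  show "1 *\<^sub>C R = R" by transfer (simp add: scaleC_one)
qed

end

definition is_adjoint :: "'h::chilbert_space bop \<Rightarrow> 'h bop \<Rightarrow> bool"
  where "is_adjoint T S \<longleftrightarrow> (\<forall>x y. cinner (bop_apply S x) y = cinner x (bop_apply T y))"

lemma is_adjoint_unique:
  assumes "is_adjoint T S" "is_adjoint T S'"
  shows "S = S'"
proof -
  have "bop_apply S x = bop_apply S' x" for x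
  proof -
    have "inner (bop_apply S x) y = inner (bop_apply S' x) y" for y
      using assms by (simp add: is_adjoint_def inner_eq_Re_cinner)
    then show ?thesis
      by (metis inner_diff_left inner_eq_zero_iff right_minus_eq)
  qed
  then show ?thesis
    by (metis bop_apply_inject ext)
qed

text \<open>The adjoint \<open>T\<^sup>*\<close>. Only operators in a von Neumann algebra are used below; there the
  adjoint exists by closure under \<open>*\<close>, so no appeal to the Riesz theorem is built in.\<close>

definition adj :: "'h::chilbert_space bop \<Rightarrow> 'h bop"
  where "adj T = (THE S. is_adjoint T S)"

lemma adj_eqI: "is_adjoint T S \<Longrightarrow> adj T = S"
  unfolding adj_def by (rule the_equality) (auto intro: is_adjoint_unique)

definition selfadjoint :: "'h::chilbert_space bop \<Rightarrow> bool"
  where "selfadjoint T \<longleftrightarrow> is_adjoint T T"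

text \<open>\<open>\<real>\<^sub>\<ge>\<^sub>0\<close> is a set of complex numbers here: the quadratic form is real and nonnegative.\<close>

definition positive_bop :: "'h::chilbert_space bop \<Rightarrow> bool"
  where "positive_bop T \<longleftrightarrow> (\<forall>x. cinner x (bop_apply T x) \<in> \<real>\<^sub>\<ge>\<^sub>0)"

definition bop_le :: "'h::chilbert_space bop \<Rightarrow> 'h bop \<Rightarrow> bool"
  where "bop_le S T \<longleftrightarrow> positive_bop (T - S)"

section \<open>Von Neumann algebras\<close>

definition commutant :: "'h::chilbert_space bop set \<Rightarrow> 'h bop set"
  where "commutant A = {T. \<forall>S\<in>A. S * T = T * S}"

definition von_neumann_algebra :: "'h::chilbert_space bop set \<Rightarrow> bool"
  where "von_neumann_algebra M \<longleftrightarrow>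
    csubspace M \<and> 1 \<in> M \<and> (\<forall>S\<in>M. \<forall>T\<in>M. S * T \<in> M) \<and>
    (\<forall>T\<in>M. \<exists>S\<in>M. is_adjoint T S) \<and>
    commutant (commutant M) = M"

text \<open>Subalgebras share the unit of \<open>M\<close>, as required for a unital map onto them.\<close>

definition von_neumann_subalgebra :: "'h::chilbert_space bop set \<Rightarrow> 'h bop set \<Rightarrow> bool"
  where "von_neumann_subalgebra N M \<longleftrightarrow> von_neumann_algebra N \<and> N \<subseteq> M"

definition abelian :: "'h::chilbert_space bop set \<Rightarrow> bool"
  where "abelian N \<longleftrightarrow> (\<forall>S\<in>N. \<forall>T\<in>N. S * T = T * S)"

subsection \<open>Normal states and normal maps\<close>

text \<open>Normality is preservation of suprema of bounded increasing nets of self-adjoint elements.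
  Such a net is represented by its range, an upward directed set.\<close>

definition directed_bop :: "'h::chilbert_space bop set \<Rightarrow> bool"
  where "directed_bop D \<longleftrightarrow> D \<noteq> {} \<and> (\<forall>S\<in>D. \<forall>T\<in>D. \<exists>U\<in>D. bop_le S U \<and> bop_le T U)"

definition bop_lub_in :: "'h::chilbert_space bop set \<Rightarrow> 'h bop set \<Rightarrow> 'h bop \<Rightarrow> bool"
  where "bop_lub_in M D S \<longleftrightarrow>
    S \<in> M \<and> selfadjoint S \<and> (\<forall>T\<in>D. bop_le T S) \<and>
    (\<forall>U\<in>M. selfadjoint U \<and> (\<forall>T\<in>D. bop_le T U) \<longrightarrow> bop_le S U)"

definition normal_map ::
    "'h::chilbert_space bop set \<Rightarrow> 'h bop set \<Rightarrow> ('h bop \<Rightarrow> 'h bop) \<Rightarrow> bool"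
  where "normal_map M N f \<longleftrightarrow>
    (\<forall>D S. D \<subseteq> M \<and> (\<forall>T\<in>D. selfadjoint T) \<and> directed_bop D \<and> bop_lub_in M D S
      \<longrightarrow> bop_lub_in N (f ` D) (f S))"

text \<open>A functional is a function on all operators of which only the values on \<open>M\<close> matter.
  A state is real on self-adjoint elements, so taking \<open>Re\<close> loses nothing.\<close>

definition state_on :: "'h::chilbert_space bop set \<Rightarrow> ('h bop \<Rightarrow> complex) \<Rightarrow> bool"
  where "state_on M \<phi> \<longleftrightarrow>
    clinear_on M \<phi> \<and> (\<forall>T\<in>M. positive_bop T \<longrightarrow> \<phi> T \<in> \<real>\<^sub>\<ge>\<^sub>0) \<and> \<phi> 1 = 1"

definition faithful_on :: "'h::chilbert_space bop set \<Rightarrow> ('h bop \<Rightarrow> complex) \<Rightarrow> bool"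
  where "faithful_on M \<phi> \<longleftrightarrow> (\<forall>T\<in>M. positive_bop T \<and> \<phi> T = 0 \<longrightarrow> T = 0)"

definition normal_functional :: "'h::chilbert_space bop set \<Rightarrow> ('h bop \<Rightarrow> complex) \<Rightarrow> bool"
  where "normal_functional M \<phi> \<longleftrightarrow>
    (\<forall>D S. D \<subseteq> M \<and> (\<forall>T\<in>D. selfadjoint T) \<and> directed_bop D \<and> bop_lub_in M D S
      \<longrightarrow> bdd_above ((\<lambda>T. Re (\<phi> T)) ` D) \<and> Re (\<phi> S) = (SUP T\<in>D. Re (\<phi> T)))"

definition faithful_normal_state :: "'h::chilbert_space bop set \<Rightarrow> ('h bop \<Rightarrow> complex) \<Rightarrow> bool"
  where "faithful_normal_state M \<phi> \<longleftrightarrow>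
    state_on M \<phi> \<and> faithful_on M \<phi> \<and> normal_functional M \<phi>"

subsection \<open>Conditional expectations\<close>

text \<open>Positivity of the operator matrix \<open>(X i j)\<close>, \<open>i, j < n\<close>, acting on \<open>H\<^sup>n\<close>.\<close>

definition positive_matrix :: "nat \<Rightarrow> (nat \<Rightarrow> nat \<Rightarrow> 'h::chilbert_space bop) \<Rightarrow> bool"
  where "positive_matrix n X \<longleftrightarrow>
    (\<forall>\<xi>. (\<Sum>i<n. \<Sum>j<n. cinner (\<xi> i) (bop_apply (X i j) (\<xi> j))) \<in> \<real>\<^sub>\<ge>\<^sub>0)"

definition completely_positive_on ::
    "'h::chilbert_space bop set \<Rightarrow> ('h bop \<Rightarrow> 'h bop) \<Rightarrow> bool"
  where "completely_positive_on M f \<longleftrightarrow>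
    clinear_on M f \<and>
    (\<forall>n X. (\<forall>i<n. \<forall>j<n. X i j \<in> M) \<and> positive_matrix n X
      \<longrightarrow> positive_matrix n (\<lambda>i j. f (X i j)))"

definition conditional_expectation ::
    "'h::chilbert_space bop set \<Rightarrow> 'h bop set \<Rightarrow> ('h bop \<Rightarrow> 'h bop) \<Rightarrow> bool"
  where "conditional_expectation M N E \<longleftrightarrow>
    completely_positive_on M E \<and> E 1 = 1 \<and> E ` M = N \<and> (\<forall>X\<in>M. E (E X) = E X) \<and>
    (\<forall>a\<in>N. \<forall>b\<in>N. \<forall>X\<in>M. E (a * X * b) = a * E X * b)"

definition state_preserving ::
    "'h::chilbert_space bop set \<Rightarrow> ('h bop \<Rightarrow> complex) \<Rightarrow> ('h bop \<Rightarrow> 'h bop) \<Rightarrow> bool"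
  where "state_preserving M \<phi> E \<longleftrightarrow> (\<forall>X\<in>M. \<phi> (E X) = \<phi> X)"

section \<open>The space \<open>L\<^sup>2(M, \<phi>)\<close>\<close>

definition state_inner :: "('h::chilbert_space bop \<Rightarrow> complex) \<Rightarrow> 'h bop \<Rightarrow> 'h bop \<Rightarrow> complex"
  where "state_inner \<phi> X Y = \<phi> (adj X * Y)"

definition norm2 :: "('h::chilbert_space bop \<Rightarrow> complex) \<Rightarrow> 'h bop \<Rightarrow> real"
  where "norm2 \<phi> X = sqrt (Re (state_inner \<phi> X X))"

text \<open>The Hilbert space completion depends on the terms \<open>M\<close> and \<open>\<phi>\<close>, so it is a set rather than
  a type: the Cauchy sequences in \<open>M\<close> with respect to \<open>norm2 \<phi>\<close> modulo the null sequences.\<close>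

definition L2_cauchy ::
    "'h::chilbert_space bop set \<Rightarrow> ('h bop \<Rightarrow> complex) \<Rightarrow> (nat \<Rightarrow> 'h bop) set"
  where "L2_cauchy M \<phi> = {s. (\<forall>n. s n \<in> M) \<and>
    (\<forall>e>0. \<exists>k. \<forall>m\<ge>k. \<forall>n\<ge>k. norm2 \<phi> (s m - s n) < e)}"

definition L2_rel ::
    "'h::chilbert_space bop set \<Rightarrow> ('h bop \<Rightarrow> complex) \<Rightarrow> ((nat \<Rightarrow> 'h bop) \<times> (nat \<Rightarrow> 'h bop)) set"
  where "L2_rel M \<phi> = {(s, t). s \<in> L2_cauchy M \<phi> \<and> t \<in> L2_cauchy M \<phi> \<and>
    (\<lambda>n. norm2 \<phi> (s n - t n)) \<longlonglongrightarrow> 0}"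

definition L2_space ::
    "'h::chilbert_space bop set \<Rightarrow> ('h bop \<Rightarrow> complex) \<Rightarrow> (nat \<Rightarrow> 'h bop) set set"
  where "L2_space M \<phi> = L2_cauchy M \<phi> // L2_rel M \<phi>"

definition L2_class ::
    "'h::chilbert_space bop set \<Rightarrow> ('h bop \<Rightarrow> complex) \<Rightarrow> (nat \<Rightarrow> 'h bop) \<Rightarrow> (nat \<Rightarrow> 'h bop) set"
  where "L2_class M \<phi> s = L2_rel M \<phi> `` {s}"

definition L2_embed ::
    "'h::chilbert_space bop set \<Rightarrow> ('h bop \<Rightarrow> complex) \<Rightarrow> 'h bop \<Rightarrow> (nat \<Rightarrow> 'h bop) set"
  where "L2_embed M \<phi> X = L2_class M \<phi> (\<lambda>_. X)"

text \<open>The operations are computed on representatives; the unions in the next two definitions are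
  over copies of one and the same class.\<close>

definition L2_add ::
    "'h::chilbert_space bop set \<Rightarrow> ('h bop \<Rightarrow> complex) \<Rightarrow>
      (nat \<Rightarrow> 'h bop) set \<Rightarrow> (nat \<Rightarrow> 'h bop) set \<Rightarrow> (nat \<Rightarrow> 'h bop) set"
  where "L2_add M \<phi> u v = (\<Union>s\<in>u. \<Union>t\<in>v. L2_class M \<phi> (\<lambda>n. s n + t n))"

definition L2_scale ::
    "'h::chilbert_space bop set \<Rightarrow> ('h bop \<Rightarrow> complex) \<Rightarrow>
      complex \<Rightarrow> (nat \<Rightarrow> 'h bop) set \<Rightarrow> (nat \<Rightarrow> 'h bop) set"
  where "L2_scale M \<phi> a u = (\<Union>s\<in>u. L2_class M \<phi> (\<lambda>n. a *\<^sub>C s n))"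

definition L2_inner ::
    "('h::chilbert_space bop \<Rightarrow> complex) \<Rightarrow>
      (nat \<Rightarrow> 'h bop) set \<Rightarrow> (nat \<Rightarrow> 'h bop) set \<Rightarrow> complex"
  where "L2_inner \<phi> u v =
    (THE z. \<forall>s\<in>u. \<forall>t\<in>v. (\<lambda>n. state_inner \<phi> (s n) (t n)) \<longlonglongrightarrow> z)"

definition L2_norm ::
    "('h::chilbert_space bop \<Rightarrow> complex) \<Rightarrow> (nat \<Rightarrow> 'h bop) set \<Rightarrow> real"
  where "L2_norm \<phi> u = sqrt (Re (L2_inner \<phi> u u))"

text \<open>Operators on the carrier \<open>L2_space M \<phi>\<close> are extensional functions (\<open>undefined\<close> outside the
  carrier), so that equality of operators is equality on \<open>L\<^sup>2(M, \<phi>)\<close>.\<close>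

definition L2_bounded_operator ::
    "'h::chilbert_space bop set \<Rightarrow> ('h bop \<Rightarrow> complex) \<Rightarrow>
      ((nat \<Rightarrow> 'h bop) set \<Rightarrow> (nat \<Rightarrow> 'h bop) set) \<Rightarrow> bool"
  where "L2_bounded_operator M \<phi> T \<longleftrightarrow>
    T \<in> L2_space M \<phi> \<rightarrow>\<^sub>E L2_space M \<phi> \<and>
    (\<forall>u\<in>L2_space M \<phi>. \<forall>v\<in>L2_space M \<phi>. T (L2_add M \<phi> u v) = L2_add M \<phi> (T u) (T v)) \<and>
    (\<forall>a. \<forall>u\<in>L2_space M \<phi>. T (L2_scale M \<phi> a u) = L2_scale M \<phi> a (T u)) \<and>
    (\<exists>K. \<forall>u\<in>L2_space M \<phi>. L2_norm \<phi> (T u) \<le> K * L2_norm \<phi> u)"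

definition L2_opnorm ::
    "'h::chilbert_space bop set \<Rightarrow> ('h bop \<Rightarrow> complex) \<Rightarrow>
      ((nat \<Rightarrow> 'h bop) set \<Rightarrow> (nat \<Rightarrow> 'h bop) set) \<Rightarrow> real"
  where "L2_opnorm M \<phi> T = (SUP u\<in>{u \<in> L2_space M \<phi>. L2_norm \<phi> u \<le> 1}. L2_norm \<phi> (T u))"

definition L2_extends ::
    "'h::chilbert_space bop set \<Rightarrow> ('h bop \<Rightarrow> complex) \<Rightarrow> ('h bop \<Rightarrow> 'h bop) \<Rightarrow>
      ((nat \<Rightarrow> 'h bop) set \<Rightarrow> (nat \<Rightarrow> 'h bop) set) \<Rightarrow> bool"
  where "L2_extends M \<phi> E T \<longleftrightarrow> (\<forall>X\<in>M. T (L2_embed M \<phi> X) = L2_embed M \<phi> (E X))"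

end

theory Submission
  imports Defs
begin

text \<open>Complete positivity at level 2, applied to the matrix with rows \<open>(1, X)\<close> and
  \<open>(X\<^sup>*, X\<^sup>* X)\<close>, forces \<open>E(X\<^sup>*) = E(X)\<^sup>*\<close>. Bimodularity and invariance of the state then give
  \<open>\<phi>(X\<^sup>* A) = \<phi>(E(X\<^sup>* A)) = \<phi>(E(X)\<^sup>* A)\<close> for \<open>A \<in> N\<close>, so \<open>E\<close> is the orthogonal projection of \<open>M\<close>
  onto \<open>N\<close> for the inner product of the state. The choice \<open>A = E(X)\<close> and the Cauchy--Schwarz
  inequality show that \<open>E\<close> is a contraction, which extends to the completion by density.\<close>

section \<open>Operators and adjoints\<close>

lemma scaleC_zero_left [simp]: "0 *\<^sub>C (x::'a::complex_vector) = 0"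
  using scaleC_add_left[of 0 0 x] by simp

lemma scaleC_minus_left: "(- a) *\<^sub>C (x::'a::complex_vector) = - (a *\<^sub>C x)"
  using scaleC_add_left[of a "- a" x] by (simp add: eq_neg_iff_add_eq_0 add.commute)

lemma csubspace_diff:
  assumes "csubspace V" "x \<in> V" "y \<in> V"
  shows "x - y \<in> V"
proof -
  have "x + (-1) *\<^sub>C y \<in> V"
    using assms unfolding csubspace_def by blast
  then show ?thesis
    by (simp add: scaleC_minus_left scaleC_one)
qed

lemma clinear_on_diff:
  assumes "clinear_on V f" "csubspace V" "x \<in> V" "y \<in> V"
  shows "f (x - y) = f x - f y"
proof -
  have "f (x + (-1) *\<^sub>C y) = f x + (-1) *\<^sub>C f y"
    using assms unfolding clinear_on_def csubspace_def by metis
  then show ?thesis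
    by (simp add: scaleC_minus_left scaleC_one)
qed

lemma cinner_add_left: "cinner (x + y) (z::'a::chilbert_space) = cinner x z + cinner y z"
  by (metis cinner_add_right cinner_commute complex_cnj_add)

lemma cinner_scaleC_left: "cinner (a *\<^sub>C x) (z::'a::chilbert_space) = cnj a * cinner x z"
  by (metis cinner_commute cinner_scaleC_right complex_cnj_mult)

lemma cinner_zero_left [simp]: "cinner 0 (z::'a::chilbert_space) = 0"
  using cinner_add_left[of 0 0 z] by simp

lemma cinner_zero_right [simp]: "cinner (z::'a::chilbert_space) 0 = 0"
  using cinner_add_right[of z 0 0] by simp

lemma scaleC_bop_mult_left: "(a *\<^sub>C S) * T = a *\<^sub>C (S * (T::'h::chilbert_space bop))"
  by transfer simp

lemma scaleC_bop_mult_right: "S * (a *\<^sub>C T) = a *\<^sub>C (S * (T::'h::chilbert_space bop))"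
  by transfer auto

lemma is_adjoint_add:
  "is_adjoint S S' \<Longrightarrow> is_adjoint T T' \<Longrightarrow> is_adjoint (S + T) (S' + T')"
  unfolding is_adjoint_def by transfer (simp add: cinner_add_left cinner_add_right)

lemma is_adjoint_scaleC: "is_adjoint S S' \<Longrightarrow> is_adjoint (a *\<^sub>C S) (cnj a *\<^sub>C S')"
  unfolding is_adjoint_def by transfer (simp add: cinner_scaleC_left cinner_scaleC_right)

lemma bop_apply_mult: "bop_apply (S * T) x = bop_apply S (bop_apply T x)"
  by transfer simp

lemma bop_apply_one [simp]: "bop_apply 1 x = x"
  by transfer simp

lemma bop_apply_zero_right [simp]: "bop_apply T 0 = 0"
  by transfer (simp add: linear_simps)

lemma bop_apply_scaleC: "bop_apply T (a *\<^sub>C x) = a *\<^sub>C bop_apply T x"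
  by transfer simp

lemma cinner_adjoint_right:
  "is_adjoint T S \<Longrightarrow> cinner x (bop_apply S y) = cinner (bop_apply T x) y"
  by (metis cinner_commute is_adjoint_def)

lemma cinner_self_nonneg: "cinner x (x::'a::chilbert_space) \<in> \<real>\<^sub>\<ge>\<^sub>0"
  by (simp add: cinner_self)

section \<open>Membership and adjoints in a von Neumann algebra\<close>

lemma von_neumann_algebra_csubspace: "von_neumann_algebra M \<Longrightarrow> csubspace M"
  by (simp add: von_neumann_algebra_def)

lemma von_neumann_algebra_one: "von_neumann_algebra M \<Longrightarrow> 1 \<in> M"
  by (simp add: von_neumann_algebra_def)

lemma von_neumann_algebra_mult: "von_neumann_algebra M \<Longrightarrow> S \<in> M \<Longrightarrow> T \<in> M \<Longrightarrow> S * T \<in> M"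
  by (simp add: von_neumann_algebra_def)

text \<open>\<open>adj\<close> is a definite description, so it denotes an adjoint only once one
  exists; closure of \<open>M\<close> under adjoints supplies the witness.\<close>

lemma von_neumann_algebra_adj:
  assumes "von_neumann_algebra M" "T \<in> M"
  shows "is_adjoint T (adj T)" and "adj T \<in> M"
proof -
  obtain S where "S \<in> M" "is_adjoint T S"
    using assms by (auto simp: von_neumann_algebra_def)
  moreover from this have "adj T = S"
    by (simp add: adj_eqI)
  ultimately show "is_adjoint T (adj T)" "adj T \<in> M"
    by simp_all
qed

lemma positive_bop_adjoint_mult:
  assumes "is_adjoint T S"
  shows "positive_bop (S * T)"
  unfolding positive_bop_def
  by (simp add: bop_apply_mult cinner_adjoint_right[OF assms] cinner_self_nonneg)

text \<open>A positive operator matrix has a real quadratic form, and realness alone ties its two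
  off-diagonal entries together as adjoints. Naming \<open>f S\<close> as the candidate yields the
  adjoint of \<open>f X\<close> directly, so no existence argument is required.\<close>

lemma completely_positive_on_adjoint:
  assumes M: "von_neumann_algebra M" and f: "completely_positive_on M f"
    and X: "X \<in> M" and adj: "is_adjoint X S" and S: "S \<in> M"
  shows "is_adjoint (f X) (f S)"
proof -
  define Y where
    "Y i j = (if i = 0 then (if j = 0 then 1 else X) else (if j = 0 then S else S * X))"
    for i j :: nat
  have two: "{..<2::nat} = {0, 1}"
    by auto
  have "positive_matrix 2 Y"
    unfolding positive_matrix_def
  proof
    fix \<xi> :: "nat \<Rightarrow> 'a"
    \<comment> \<open>Since \<open>S\<close> is the adjoint of \<open>X\<close>, the matrix is the
      Gram-type product of the row \<open>(1, X)\<close> with itself, and its form collapses to the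
      squared norm of this vector.\<close>
    let ?v = "\<xi> 0 + bop_apply X (\<xi> 1)"
    have "(\<Sum>i<2. \<Sum>j<2. cinner (\<xi> i) (bop_apply (Y i j) (\<xi> j))) = cinner ?v ?v"
      by (simp add: two Y_def bop_apply_mult cinner_adjoint_right[OF adj] cinner_add_left
          cinner_add_right)
    then show "(\<Sum>i<2. \<Sum>j<2. cinner (\<xi> i) (bop_apply (Y i j) (\<xi> j))) \<in> \<real>\<^sub>\<ge>\<^sub>0"
      by (simp only: cinner_self_nonneg)
  qed
  moreover have "\<forall>i<2. \<forall>j<2. Y i j \<in> M"
    using von_neumann_algebra_one[OF M] von_neumann_algebra_mult[OF M S X] X S
    by (simp add: Y_def)
  ultimately have pos: "positive_matrix 2 (\<lambda>i j. f (Y i j))"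
    using f unfolding completely_positive_on_def by blast
  have real: "Im (cinner a (bop_apply (f 1) a) + cinner a (bop_apply (f X) b)
      + cinner b (bop_apply (f S) a) + cinner b (bop_apply (f (S * X)) b)) = 0" for a b
  proof -
    have "(\<Sum>i<2. \<Sum>j<2. cinner ((\<lambda>i::nat. if i = 0 then a else b) i)
        (bop_apply (f (Y i j)) ((\<lambda>i. if i = 0 then a else b) j))) \<in> \<real>\<^sub>\<ge>\<^sub>0"
      using pos unfolding positive_matrix_def by (rule spec)
    then show ?thesis
      by (simp add: two Y_def complex_nonneg_Reals_iff algebra_simps)
  qed
  \<comment> \<open>Setting \<open>b = 0\<close> or \<open>a = 0\<close> shows that each diagonal
    term is real by itself; subtracting both leaves the imaginary parts of the off-diagonal
    terms.\<close>
  have cross: "Im (cinner a (bop_apply (f X) b)) = Im (cinner (bop_apply (f S) a) b)" for a b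
  proof -
    have "Im (cinner a (bop_apply (f X) b) + cinner b (bop_apply (f S) a)) = 0"
      using real[of a b] real[of a 0] real[of 0 b] by simp
    moreover have "Im (cinner (bop_apply (f S) a) b) = - Im (cinner b (bop_apply (f S) a))"
      by (subst cinner_commute) simp
    ultimately show ?thesis
      by simp
  qed
  show ?thesis
    unfolding is_adjoint_def
  proof (intro allI)
    fix x y
    \<comment> \<open>Replacing \<open>y\<close> by \<open>\<i> *\<^sub>C y\<close> multiplies both
      sides by \<open>\<i>\<close>, so equality of imaginary parts becomes equality of real
      parts.\<close>
    have "Re (cinner x (bop_apply (f X) y)) = Re (cinner (bop_apply (f S) x) y)"
      using cross[of x "\<i> *\<^sub>C y"] by (simp add: bop_apply_scaleC cinner_scaleC_right)
    then show "cinner (bop_apply (f S) x) y = cinner x (bop_apply (f X) y)"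
      using cross[of x y] by (simp add: complex_eq_iff)
  qed
qed

section \<open>The seminorm of a state\<close>

text \<open>Gathers the closure of \<open>M\<close> and the positivity of the state, the source of
  Hermitian symmetry, the Cauchy-Schwarz inequality and the seminorm below.\<close>

locale state_form =
  fixes M :: "'h::chilbert_space bop set" and \<phi> :: "'h bop \<Rightarrow> complex"
  assumes vna: "von_neumann_algebra M" and state: "state_on M \<phi>"
begin

lemma add_closed: "X \<in> M \<Longrightarrow> Y \<in> M \<Longrightarrow> X + Y \<in> M"
  using von_neumann_algebra_csubspace[OF vna] by (simp add: csubspace_def)

lemma scaleC_closed: "X \<in> M \<Longrightarrow> a *\<^sub>C X \<in> M"
  using von_neumann_algebra_csubspace[OF vna] by (simp add: csubspace_def)

lemma zero_closed: "0 \<in> M"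
  using von_neumann_algebra_csubspace[OF vna] by (simp add: csubspace_def)

lemma diff_closed: "X \<in> M \<Longrightarrow> Y \<in> M \<Longrightarrow> X - Y \<in> M"
  using csubspace_diff von_neumann_algebra_csubspace[OF vna] by blast

lemmas mult_closed = von_neumann_algebra_mult[OF vna]
lemmas is_adjoint_adj = von_neumann_algebra_adj(1)[OF vna]
lemmas adj_closed = von_neumann_algebra_adj(2)[OF vna]
lemmas closed = add_closed scaleC_closed zero_closed diff_closed mult_closed adj_closed

lemma state_add: "X \<in> M \<Longrightarrow> Y \<in> M \<Longrightarrow> \<phi> (X + Y) = \<phi> X + \<phi> Y"
  using state by (simp add: state_on_def clinear_on_def)

lemma state_scaleC: "X \<in> M \<Longrightarrow> \<phi> (a *\<^sub>C X) = a * \<phi> X"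
  using state by (simp add: state_on_def clinear_on_def scaleC_complex_def)

section \<open>Sesquilinearity and positivity of the form of the state\<close>

lemma state_inner_add_right:
  "X \<in> M \<Longrightarrow> Y \<in> M \<Longrightarrow> Z \<in> M \<Longrightarrow> state_inner \<phi> X (Y + Z) = state_inner \<phi> X Y + state_inner \<phi> X Z"
  by (simp add: state_inner_def distrib_left state_add closed)

lemma state_inner_scaleC_right:
  "X \<in> M \<Longrightarrow> Y \<in> M \<Longrightarrow> state_inner \<phi> X (a *\<^sub>C Y) = a * state_inner \<phi> X Y"
  by (simp add: state_inner_def scaleC_bop_mult_right state_scaleC closed)

text \<open>Additivity of \<open>adj\<close> is not definitional: it follows from uniqueness of
  adjoints, by exhibiting the sum of the adjoints as an adjoint of the sum.\<close>

lemma state_inner_add_left: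
  assumes "X \<in> M" "Y \<in> M" "Z \<in> M"
  shows "state_inner \<phi> (X + Y) Z = state_inner \<phi> X Z + state_inner \<phi> Y Z"
proof -
  have "adj (X + Y) = adj X + adj Y"
    using assms by (intro adj_eqI is_adjoint_add is_adjoint_adj)
  then show ?thesis
    using assms by (simp add: state_inner_def distrib_right state_add closed)
qed

lemma state_inner_scaleC_left:
  assumes "X \<in> M" "Y \<in> M"
  shows "state_inner \<phi> (a *\<^sub>C X) Y = cnj a * state_inner \<phi> X Y"
proof -
  have "adj (a *\<^sub>C X) = cnj a *\<^sub>C adj X"
    using assms by (intro adj_eqI is_adjoint_scaleC is_adjoint_adj)
  then show ?thesis
    using assms by (simp add: state_inner_def scaleC_bop_mult_left state_scaleC closed)
qed

lemmas state_inner_simps = state_inner_add_left state_inner_add_right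
  state_inner_scaleC_left state_inner_scaleC_right

lemma state_inner_nonneg: "X \<in> M \<Longrightarrow> state_inner \<phi> X X \<in> \<real>\<^sub>\<ge>\<^sub>0"
  using state positive_bop_adjoint_mult[OF is_adjoint_adj]
  by (simp add: state_inner_def state_on_def closed)

lemma norm2_nonneg: "X \<in> M \<Longrightarrow> 0 \<le> norm2 \<phi> X"
  using state_inner_nonneg by (simp add: norm2_def complex_nonneg_Reals_iff)

lemma state_inner_self: "X \<in> M \<Longrightarrow> state_inner \<phi> X X = complex_of_real ((norm2 \<phi> X)\<^sup>2)"
  using state_inner_nonneg[of X]
  by (simp add: norm2_def complex_nonneg_Reals_iff complex_eq_iff del: of_real_power)

text \<open>Polarization: the form is real on the diagonal, and its values at \<open>X + Y\<close>
  and \<open>X + \<i> *\<^sub>C Y\<close> control the imaginary and real parts of the cross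
  terms.\<close>

lemma state_inner_commute:
  assumes X: "X \<in> M" and Y: "Y \<in> M"
  shows "state_inner \<phi> Y X = cnj (state_inner \<phi> X Y)"
proof -
  have real: "Im (state_inner \<phi> Z Z) = 0" if "Z \<in> M" for Z
    using state_inner_nonneg[OF that] by (simp add: complex_nonneg_Reals_iff)
  have "Im (state_inner \<phi> X Y) + Im (state_inner \<phi> Y X) = 0"
    using real[of "X + Y"] X Y by (simp add: state_inner_simps closed real)
  moreover have "Re (state_inner \<phi> X Y) - Re (state_inner \<phi> Y X) = 0"
    using real[of "X + \<i> *\<^sub>C Y"] X Y by (simp add: state_inner_simps closed real)
  ultimately show ?thesis
    by (simp add: complex_eq_iff)
qed

text \<open>The form is nonnegative at \<open>t Y - c X\<close> with \<open>c\<close> the inner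
  product of \<open>X\<close> and \<open>Y\<close>. The factor \<open>c\<close> makes both cross
  terms equal to the real number \<open>- t |c|^2\<close>, so a real quadratic in \<open>t\<close>
  remains.\<close>

lemma state_inner_Cauchy_Schwarz:
  assumes X: "X \<in> M" and Y: "Y \<in> M"
  shows "norm (state_inner \<phi> X Y) \<le> norm2 \<phi> X * norm2 \<phi> Y"
proof -
  define c where "c = state_inner \<phi> X Y"
  define x where "x = (norm2 \<phi> X)\<^sup>2"
  define y where "y = (norm2 \<phi> Y)\<^sup>2"
  have form: "0 \<le> t\<^sup>2 * y - 2 * t * (norm c)\<^sup>2 + (norm c)\<^sup>2 * x" for t :: real
  proof -
    let ?Z = "complex_of_real t *\<^sub>C Y + (- c) *\<^sub>C X"
    have "state_inner \<phi> ?Z ?Z = of_real t * of_real t * state_inner \<phi> Y Y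
        - of_real t * (c * cnj c) - of_real t * (c * cnj c) + (c * cnj c) * state_inner \<phi> X X"
      using X Y by (simp add: state_inner_simps closed state_inner_commute[OF X Y]
          c_def[symmetric] algebra_simps)
    also have "\<dots> = of_real t * of_real t * of_real y
        - of_real t * (c * cnj c) - of_real t * (c * cnj c) + (c * cnj c) * of_real x"
      unfolding x_def y_def state_inner_self[OF X] state_inner_self[OF Y] ..
    also have "\<dots> = complex_of_real (t\<^sup>2 * y - 2 * t * (norm c)\<^sup>2 + (norm c)\<^sup>2 * x)"
      by (simp add: complex_norm_square[symmetric] power2_eq_square)
    finally have "complex_of_real (t\<^sup>2 * y - 2 * t * (norm c)\<^sup>2 + (norm c)\<^sup>2 * x) \<in> \<real>\<^sub>\<ge>\<^sub>0"
      using state_inner_nonneg[of ?Z] X Y by (metis add_closed scaleC_closed)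
    then show ?thesis
      by (simp only: nonneg_Reals_of_real_iff)
  qed
  have "(norm c)\<^sup>2 \<le> x * y"
  proof (cases "c = 0")
    case True
    then show ?thesis by (simp add: x_def y_def)
  next
    case False
    then have c: "(norm c)\<^sup>2 > 0" by simp
    show ?thesis
    proof (cases "y = 0")
      case True
      \<comment> \<open>For \<open>y = 0\<close> the quadratic is affine in \<open>t\<close> with
        slope \<open>-2 |c|^2\<close>; the value \<open>t = x + 1\<close> already makes it negative,
        a contradiction.\<close>
      have "0 \<le> (norm c)\<^sup>2 * (- x - 2)"
        using form[of "x + 1"] True by (simp add: algebra_simps)
      then have "0 \<le> - x - 2"
        using c by (simp add: zero_le_mult_iff)
      moreover have "0 \<le> x" by (simp add: x_def)
      ultimately show ?thesis by simp
    next
      case False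
      then have y: "y > 0" by (simp add: y_def)
      \<comment> \<open>The choice \<open>t = |c|^2 / y\<close> is the minimizer of the
        quadratic.\<close>
      have "0 \<le> (norm c)\<^sup>2 * (x - (norm c)\<^sup>2 / y)"
        using form[of "(norm c)\<^sup>2 / y"] y by (simp add: field_simps power2_eq_square)
      then have "(norm c)\<^sup>2 / y \<le> x"
        using c by (simp add: zero_le_mult_iff)
      then show ?thesis
        using y by (simp add: field_simps)
    qed
  qed
  then have "(norm c)\<^sup>2 \<le> (norm2 \<phi> X * norm2 \<phi> Y)\<^sup>2"
    by (simp add: x_def y_def power_mult_distrib)
  then show ?thesis
    using X Y by (simp add: c_def norm2_nonneg power2_le_iff_abs_le)
qed

section \<open>Seminorm properties of \<open>norm2 \<phi>\<close>\<close>

lemma norm2_add_le: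
  assumes X: "X \<in> M" and Y: "Y \<in> M"
  shows "norm2 \<phi> (X + Y) \<le> norm2 \<phi> X + norm2 \<phi> Y"
proof -
  have "complex_of_real ((norm2 \<phi> (X + Y))\<^sup>2) = state_inner \<phi> (X + Y) (X + Y)"
    by (rule state_inner_self[OF add_closed[OF X Y], symmetric])
  also have "\<dots>
      = state_inner \<phi> X X + (state_inner \<phi> X Y + cnj (state_inner \<phi> X Y)) + state_inner \<phi> Y Y"
    using X Y by (simp add: closed state_inner_simps state_inner_commute[OF X Y])
  also have "\<dots>
      = complex_of_real ((norm2 \<phi> X)\<^sup>2 + 2 * Re (state_inner \<phi> X Y) + (norm2 \<phi> Y)\<^sup>2)"
    unfolding state_inner_self[OF X] state_inner_self[OF Y] complex_add_cnj by simp
  finally have "(norm2 \<phi> (X + Y))\<^sup>2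
      = (norm2 \<phi> X)\<^sup>2 + 2 * Re (state_inner \<phi> X Y) + (norm2 \<phi> Y)\<^sup>2"
    by (simp only: of_real_eq_iff)
  also have "\<dots> \<le> (norm2 \<phi> X + norm2 \<phi> Y)\<^sup>2"
    using complex_Re_le_cmod[of "state_inner \<phi> X Y"] state_inner_Cauchy_Schwarz[OF X Y]
    by (simp add: power2_sum)
  finally show ?thesis
    by (rule power2_le_imp_le) (simp add: norm2_nonneg X Y)
qed

lemma norm2_scaleC:
  assumes X: "X \<in> M"
  shows "norm2 \<phi> (a *\<^sub>C X) = norm a * norm2 \<phi> X"
proof -
  have "complex_of_real ((norm2 \<phi> (a *\<^sub>C X))\<^sup>2) = state_inner \<phi> (a *\<^sub>C X) (a *\<^sub>C X)"
    by (rule state_inner_self[OF scaleC_closed[OF X], symmetric])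
  also have "\<dots> = (a * cnj a) * state_inner \<phi> X X"
    using X by (simp add: closed state_inner_simps)
  also have "\<dots> = complex_of_real ((norm a * norm2 \<phi> X)\<^sup>2)"
    using X by (simp add: state_inner_self complex_norm_square[symmetric] power_mult_distrib)
  finally have "(norm2 \<phi> (a *\<^sub>C X))\<^sup>2 = (norm a * norm2 \<phi> X)\<^sup>2"
    by (simp only: of_real_eq_iff)
  then show ?thesis
    using X by (simp add: power2_eq_iff_nonneg norm2_nonneg closed)
qed

lemma norm2_zero [simp]: "norm2 \<phi> 0 = 0"
  using norm2_scaleC[OF zero_closed, of 0] by simp

lemma norm2_minus_commute:
  assumes "X \<in> M" "Y \<in> M"
  shows "norm2 \<phi> (X - Y) = norm2 \<phi> (Y - X)"
  using norm2_scaleC[of "X - Y" "-1"] assms by (simp add: closed scaleC_minus_left scaleC_one)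

lemma norm2_triangle:
  assumes "X \<in> M" "Y \<in> M" "Z \<in> M"
  shows "norm2 \<phi> (X - Z) \<le> norm2 \<phi> (X - Y) + norm2 \<phi> (Y - Z)"
  using norm2_add_le[of "X - Y" "Y - Z"] assms by (simp add: closed)

lemma norm2_diff_abs_le:
  assumes "X \<in> M" "Y \<in> M"
  shows "\<bar>norm2 \<phi> X - norm2 \<phi> Y\<bar> \<le> norm2 \<phi> (X - Y)"
  using norm2_triangle[of X Y 0] norm2_triangle[of Y X 0] norm2_minus_commute[of X Y] assms
  by (simp add: closed)

section \<open>The completion\<close>

lemma L2_cauchyD: "s \<in> L2_cauchy M \<phi> \<Longrightarrow> s n \<in> M"
  by (simp add: L2_cauchy_def)

lemma L2_cauchy_const: "X \<in> M \<Longrightarrow> (\<lambda>_. X) \<in> L2_cauchy M \<phi>"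
  by (simp add: L2_cauchy_def)

text \<open>A Lipschitz criterion with two uses: scalar multiples, with \<open>C = norm a\<close>,
  and termwise images under a contraction, with \<open>C = 1\<close>.\<close>

lemma L2_cauchy_contraction:
  assumes s: "s \<in> L2_cauchy M \<phi>"
    and f: "\<And>n. f n \<in> M" "\<And>m n. norm2 \<phi> (f m - f n) \<le> C * norm2 \<phi> (s m - s n)"
    and C: "0 \<le> C"
  shows "f \<in> L2_cauchy M \<phi>"
  unfolding L2_cauchy_def
proof (intro CollectI conjI allI impI)
  fix e :: real assume "0 < e"
  \<comment> \<open>Dividing by \<open>C + 1\<close> avoids a zero denominator when
    \<open>C = 0\<close>.\<close>
  then have "0 < e / (C + 1)" using C by simp
  then obtain k where k: "\<And>m n. m \<ge> k \<Longrightarrow> n \<ge> k \<Longrightarrow> norm2 \<phi> (s m - s n) < e / (C + 1)"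
    using s unfolding L2_cauchy_def by blast
  have "norm2 \<phi> (f m - f n) < e" if "m \<ge> k" "n \<ge> k" for m n
  proof -
    have "0 \<le> norm2 \<phi> (s m - s n)"
      using s by (simp add: norm2_nonneg closed L2_cauchyD)
    then have "norm2 \<phi> (f m - f n) \<le> (C + 1) * norm2 \<phi> (s m - s n)"
      using f(2)[of m n] by (simp add: algebra_simps)
    also have "\<dots> < e"
      using k[OF that] C by (simp add: field_simps)
    finally show ?thesis .
  qed
  then show "\<exists>k. \<forall>m\<ge>k. \<forall>n\<ge>k. norm2 \<phi> (f m - f n) < e" by blast
qed (use f in auto)

lemma L2_cauchy_scaleC:
  assumes "s \<in> L2_cauchy M \<phi>"
  shows "(\<lambda>n. a *\<^sub>C s n) \<in> L2_cauchy M \<phi>"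
  using assms
  by (intro L2_cauchy_contraction[where C = "norm a", OF assms])
    (simp_all add: closed L2_cauchyD scaleC_diff_right[symmetric] norm2_scaleC)

lemma L2_cauchy_add:
  assumes s: "s \<in> L2_cauchy M \<phi>" and t: "t \<in> L2_cauchy M \<phi>"
  shows "(\<lambda>n. s n + t n) \<in> L2_cauchy M \<phi>"
  unfolding L2_cauchy_def
proof (intro CollectI conjI allI impI)
  fix e :: real assume "0 < e"
  then have e: "0 < e / 2" by simp
  obtain k where k: "\<And>m n. m \<ge> k \<Longrightarrow> n \<ge> k \<Longrightarrow> norm2 \<phi> (s m - s n) < e / 2"
    using s e unfolding L2_cauchy_def by blast
  obtain l where l: "\<And>m n. m \<ge> l \<Longrightarrow> n \<ge> l \<Longrightarrow> norm2 \<phi> (t m - t n) < e / 2"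
    using t e unfolding L2_cauchy_def by blast
  have "norm2 \<phi> ((s m + t m) - (s n + t n)) < e" if "m \<ge> max k l" "n \<ge> max k l" for m n
    using norm2_add_le[of "s m - s n" "t m - t n"] k[of m n] l[of m n] that s t
    by (simp add: closed L2_cauchyD algebra_simps)
  then show "\<exists>k. \<forall>m\<ge>k. \<forall>n\<ge>k. norm2 \<phi> ((s m + t m) - (s n + t n)) < e" by blast
qed (use s t in \<open>auto simp: closed L2_cauchyD\<close>)

lemma L2_cauchy_diff:
  assumes s: "s \<in> L2_cauchy M \<phi>" and t: "t \<in> L2_cauchy M \<phi>"
  shows "(\<lambda>n. s n - t n) \<in> L2_cauchy M \<phi>"
  using L2_cauchy_add[OF s L2_cauchy_scaleC[OF t, of "-1"]]
  by (simp add: scaleC_minus_left scaleC_one)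

text \<open>The reverse triangle inequality carries the Cauchy property over to the real sequence of
  seminorms.\<close>

lemma convergent_norm2:
  assumes "s \<in> L2_cauchy M \<phi>"
  shows "convergent (\<lambda>n. norm2 \<phi> (s n))"
proof (rule real_Cauchy_convergent, rule metric_CauchyI)
  fix e :: real assume "0 < e"
  then obtain k where "\<forall>m\<ge>k. \<forall>n\<ge>k. norm2 \<phi> (s m - s n) < e"
    using assms unfolding L2_cauchy_def by blast
  then show "\<exists>k. \<forall>m\<ge>k. \<forall>n\<ge>k. dist (norm2 \<phi> (s m)) (norm2 \<phi> (s n)) < e"
    using norm2_diff_abs_le[OF L2_cauchyD[OF assms] L2_cauchyD[OF assms]]
    by (metis dist_real_def le_less_trans)
qed

section \<open>The quotient by null sequences and its vector operations\<close>

lemma L2_rel_iff: "(s, t) \<in> L2_rel M \<phi> \<longleftrightarrow>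
  s \<in> L2_cauchy M \<phi> \<and> t \<in> L2_cauchy M \<phi> \<and> (\<lambda>n. norm2 \<phi> (s n - t n)) \<longlonglongrightarrow> 0"
  by (simp add: L2_rel_def)

lemma norm2_tendsto_0I:
  assumes "\<And>n. f n \<in> M" "\<And>n. norm2 \<phi> (f n) \<le> g n" "g \<longlonglongrightarrow> 0"
  shows "(\<lambda>n. norm2 \<phi> (f n)) \<longlonglongrightarrow> 0"
  using assms by (intro tendsto_sandwich[OF _ _ tendsto_const assms(3)]) (auto simp: norm2_nonneg)

lemma equiv_L2_rel: "equiv (L2_cauchy M \<phi>) (L2_rel M \<phi>)"
proof (rule equivI)
  show "L2_rel M \<phi> \<subseteq> L2_cauchy M \<phi> \<times> L2_cauchy M \<phi>"
    by (auto simp: L2_rel_def)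
  show "refl_on (L2_cauchy M \<phi>) (L2_rel M \<phi>)"
    by (auto simp: refl_on_def L2_rel_def)
  show "sym (L2_rel M \<phi>)"
    by (auto simp: sym_def L2_rel_iff norm2_minus_commute L2_cauchyD)
  show "trans (L2_rel M \<phi>)"
  proof (rule transI)
    fix r s t assume rs: "(r, s) \<in> L2_rel M \<phi>" and st: "(s, t) \<in> L2_rel M \<phi>"
    then have lim: "(\<lambda>n. norm2 \<phi> (r n - s n) + norm2 \<phi> (s n - t n)) \<longlonglongrightarrow> 0"
      and M: "\<And>n. r n \<in> M" "\<And>n. s n \<in> M" "\<And>n. t n \<in> M"
      by (auto simp: L2_rel_iff L2_cauchyD intro!: tendsto_add_zero)
    have "(\<lambda>n. norm2 \<phi> (r n - t n)) \<longlonglongrightarrow> 0"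
      by (rule norm2_tendsto_0I[OF _ _ lim]) (simp_all add: M closed norm2_triangle)
    with rs st show "(r, t) \<in> L2_rel M \<phi>"
      by (simp add: L2_rel_iff)
  qed
qed

lemma L2_class_eq_iff:
  assumes "s \<in> L2_cauchy M \<phi>" "t \<in> L2_cauchy M \<phi>"
  shows "L2_class M \<phi> s = L2_class M \<phi> t \<longleftrightarrow> (\<lambda>n. norm2 \<phi> (s n - t n)) \<longlonglongrightarrow> 0"
  unfolding L2_class_def eq_equiv_class_iff[OF equiv_L2_rel assms]
  using assms by (simp add: L2_rel_iff)

lemma mem_L2_class: "t \<in> L2_class M \<phi> s \<longleftrightarrow> (s, t) \<in> L2_rel M \<phi>"
  by (simp add: L2_class_def)

lemma self_mem_L2_class: "s \<in> L2_cauchy M \<phi> \<Longrightarrow> s \<in> L2_class M \<phi> s"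
  by (simp add: mem_L2_class L2_rel_iff)

lemma L2_class_in_space: "s \<in> L2_cauchy M \<phi> \<Longrightarrow> L2_class M \<phi> s \<in> L2_space M \<phi>"
  by (simp add: L2_space_def L2_class_def quotientI)

lemma L2_spaceE:
  assumes "u \<in> L2_space M \<phi>"
  obtains s where "s \<in> L2_cauchy M \<phi>" "u = L2_class M \<phi> s"
  using assms by (auto simp: L2_space_def L2_class_def elim: quotientE)

text \<open>Other representatives change the sum only by a null sequence, so all classes in the
  union defining \<open>L2_add\<close> coincide. The union is nonempty because each class contains
  its own representative.\<close>

lemma L2_add_class:
  assumes s: "s \<in> L2_cauchy M \<phi>" and t: "t \<in> L2_cauchy M \<phi>"
  shows "L2_add M \<phi> (L2_class M \<phi> s) (L2_class M \<phi> t) = L2_class M \<phi> (\<lambda>n. s n + t n)"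
proof -
  have "L2_class M \<phi> (\<lambda>n. s' n + t' n) = L2_class M \<phi> (\<lambda>n. s n + t n)"
    if "s' \<in> L2_class M \<phi> s" "t' \<in> L2_class M \<phi> t" for s' t'
  proof -
    have s': "s' \<in> L2_cauchy M \<phi>" and t': "t' \<in> L2_cauchy M \<phi>"
      and lim: "(\<lambda>n. norm2 \<phi> (s n - s' n)) \<longlonglongrightarrow> 0" "(\<lambda>n. norm2 \<phi> (t n - t' n)) \<longlonglongrightarrow> 0"
      using that by (auto simp: mem_L2_class L2_rel_iff)
    have "(\<lambda>n. norm2 \<phi> ((s n + t n) - (s' n + t' n))) \<longlonglongrightarrow> 0"
    proof (rule norm2_tendsto_0I[OF _ _ tendsto_add_zero[OF lim]])
      show "norm2 \<phi> ((s n + t n) - (s' n + t' n))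
          \<le> norm2 \<phi> (s n - s' n) + norm2 \<phi> (t n - t' n)" for n
        using norm2_add_le[of "s n - s' n" "t n - t' n"] s t s' t'
        by (simp add: closed L2_cauchyD algebra_simps)
    qed (use s t s' t' in \<open>simp add: closed L2_cauchyD\<close>)
    then show ?thesis
      by (metis L2_class_eq_iff L2_cauchy_add s t s' t')
  qed
  then show ?thesis
    unfolding L2_add_def using self_mem_L2_class[OF s] self_mem_L2_class[OF t] by blast
qed

lemma L2_scale_class:
  assumes s: "s \<in> L2_cauchy M \<phi>"
  shows "L2_scale M \<phi> a (L2_class M \<phi> s) = L2_class M \<phi> (\<lambda>n. a *\<^sub>C s n)"
proof -
  have "L2_class M \<phi> (\<lambda>n. a *\<^sub>C s' n) = L2_class M \<phi> (\<lambda>n. a *\<^sub>C s n)"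
    if "s' \<in> L2_class M \<phi> s" for s'
  proof -
    have s': "s' \<in> L2_cauchy M \<phi>" and lim: "(\<lambda>n. norm2 \<phi> (s n - s' n)) \<longlonglongrightarrow> 0"
      using that by (auto simp: mem_L2_class L2_rel_iff)
    have "(\<lambda>n. norm2 \<phi> (a *\<^sub>C s n - a *\<^sub>C s' n)) \<longlonglongrightarrow> 0"
      using tendsto_mult_right_zero[OF lim, of "norm a"] s s'
      by (simp add: scaleC_diff_right[symmetric] norm2_scaleC closed L2_cauchyD)
    then show ?thesis
      by (metis L2_class_eq_iff L2_cauchy_scaleC s s')
  qed
  then show ?thesis
    unfolding L2_scale_def using self_mem_L2_class[OF s] by blast
qed

text \<open>Expresses subtraction by the two operations that \<open>L2_bounded_operator\<close> is
  assumed to respect.\<close>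

lemma L2_diff_class:
  assumes s: "s \<in> L2_cauchy M \<phi>" and t: "t \<in> L2_cauchy M \<phi>"
  shows "L2_add M \<phi> (L2_class M \<phi> s) (L2_scale M \<phi> (-1) (L2_class M \<phi> t))
    = L2_class M \<phi> (\<lambda>n. s n - t n)"
  using L2_add_class[OF s L2_cauchy_scaleC[OF t, of "-1"]]
  by (simp add: L2_scale_class[OF t] scaleC_minus_left scaleC_one)

section \<open>The norm of the completion as a limit\<close>

lemma state_inner_diff:
  assumes "X \<in> M" "Y \<in> M" "X' \<in> M" "Y' \<in> M"
  shows "state_inner \<phi> X Y - state_inner \<phi> X' Y'
    = state_inner \<phi> (X - X') Y + state_inner \<phi> X' (Y - Y')"
  using state_inner_add_left[of "X - X'" X' Y] state_inner_add_right[of X' "Y - Y'" Y'] assms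
  by (simp add: closed)

text \<open>Makes the description in \<open>L2_inner\<close> usable: the limit exists along every
  pair of representatives and is the same for all of them. Every later norm estimate passes to the
  limit through this lemma.\<close>

lemma tendsto_L2_norm:
  assumes s: "s \<in> L2_cauchy M \<phi>"
  shows "(\<lambda>n. norm2 \<phi> (s n)) \<longlonglongrightarrow> L2_norm \<phi> (L2_class M \<phi> s)"
proof -
  obtain l where l: "(\<lambda>n. norm2 \<phi> (s n)) \<longlonglongrightarrow> l"
    using convergent_norm2[OF s] by (auto simp: convergent_def)
  have "0 \<le> l"
    using l by (rule LIMSEQ_le_const) (use s in \<open>auto simp: norm2_nonneg L2_cauchyD\<close>)
  let ?z = "complex_of_real (l\<^sup>2)"
  have lim_s: "(\<lambda>n. state_inner \<phi> (s n) (s n)) \<longlonglongrightarrow> ?z"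
    using s by (simp add: state_inner_self L2_cauchyD del: of_real_power)
      (intro tendsto_of_real tendsto_power l)
  \<comment> \<open>The two arguments may run through different representatives of the class, as
    \<open>L2_inner\<close> quantifies over both.\<close>
  have lim: "(\<lambda>n. state_inner \<phi> (t n) (t' n)) \<longlonglongrightarrow> ?z"
    if "t \<in> L2_class M \<phi> s" "t' \<in> L2_class M \<phi> s" for t t'
  proof -
    have t: "t \<in> L2_cauchy M \<phi>" and t': "t' \<in> L2_cauchy M \<phi>"
      and null: "(\<lambda>n. norm2 \<phi> (s n - t n)) \<longlonglongrightarrow> 0" "(\<lambda>n. norm2 \<phi> (s n - t' n)) \<longlonglongrightarrow> 0"
      using that by (auto simp: mem_L2_class L2_rel_iff)
    obtain l' where l': "(\<lambda>n. norm2 \<phi> (t' n)) \<longlonglongrightarrow> l'"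
      using convergent_norm2[OF t'] by (auto simp: convergent_def)
    \<comment> \<open>Each summand is a null sequence times a convergent one; the sum dominates the
      difference of the inner products by Cauchy-Schwarz applied to each argument
      separately.\<close>
    have "(\<lambda>n. norm2 \<phi> (s n - t n) * norm2 \<phi> (t' n) + norm2 \<phi> (s n) * norm2 \<phi> (s n - t' n))
        \<longlonglongrightarrow> 0 * l' + l * 0"
      by (intro tendsto_intros l l' null)
    then have bound:
      "(\<lambda>n. norm2 \<phi> (s n - t n) * norm2 \<phi> (t' n) + norm2 \<phi> (s n) * norm2 \<phi> (s n - t' n)) \<longlonglongrightarrow> 0"
      by simp
    have "(\<lambda>n. state_inner \<phi> (t n) (t' n) - state_inner \<phi> (s n) (s n)) \<longlonglongrightarrow> 0"
    proof (rule Lim_null_comparison[OF always_eventually bound], rule allI)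
      fix n
      have M: "s n \<in> M" "t n \<in> M" "t' n \<in> M"
        using s t t' by (simp_all add: L2_cauchyD)
      have "norm (state_inner \<phi> (t n - s n) (t' n)) \<le> norm2 \<phi> (s n - t n) * norm2 \<phi> (t' n)"
        using state_inner_Cauchy_Schwarz[of "t n - s n" "t' n"] M
        by (simp add: closed norm2_minus_commute)
      moreover have "norm (state_inner \<phi> (s n) (t' n - s n)) \<le> norm2 \<phi> (s n) * norm2 \<phi> (s n - t' n)"
        using state_inner_Cauchy_Schwarz[of "s n" "t' n - s n"] M
        by (simp add: closed norm2_minus_commute)
      ultimately show "norm (state_inner \<phi> (t n) (t' n) - state_inner \<phi> (s n) (s n))
          \<le> norm2 \<phi> (s n - t n) * norm2 \<phi> (t' n) + norm2 \<phi> (s n) * norm2 \<phi> (s n - t' n)"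
        unfolding state_inner_diff[OF M(2,3,1,1)]
        by (meson add_mono norm_triangle_le)
    qed
    from tendsto_add[OF this lim_s] show ?thesis
      by simp
  qed
  have "L2_inner \<phi> (L2_class M \<phi> s) (L2_class M \<phi> s) = ?z"
    unfolding L2_inner_def
  proof (rule the_equality)
    show "z = ?z"
      if "\<forall>t\<in>L2_class M \<phi> s. \<forall>t'\<in>L2_class M \<phi> s. (\<lambda>n. state_inner \<phi> (t n) (t' n)) \<longlonglongrightarrow> z" for z
      using that self_mem_L2_class[OF s] lim_s LIMSEQ_unique by blast
  qed (use lim in blast)
  \<comment> \<open>Nonnegativity of \<open>l\<close> makes the square root of \<open>l^2\<close>
    equal to \<open>l\<close>.\<close>
  then have "L2_norm \<phi> (L2_class M \<phi> s) = l"
    using \<open>0 \<le> l\<close> by (simp add: L2_norm_def del: of_real_power)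
  then show ?thesis
    using l by simp
qed

section \<open>Definiteness, triangle inequality and density\<close>

lemma L2_class_null_iff:
  assumes s: "s \<in> L2_cauchy M \<phi>" and t: "t \<in> L2_cauchy M \<phi>"
  shows "L2_class M \<phi> s = L2_class M \<phi> t \<longleftrightarrow> L2_norm \<phi> (L2_class M \<phi> (\<lambda>n. s n - t n)) = 0"
  unfolding L2_class_eq_iff[OF s t]
  using tendsto_L2_norm[OF L2_cauchy_diff[OF s t]] LIMSEQ_unique by fastforce

text \<open>The last difference is oriented so that two sequences are each compared with the common
  third one.\<close>

lemma L2_norm_triangle:
  assumes r: "r \<in> L2_cauchy M \<phi>" and s: "s \<in> L2_cauchy M \<phi>" and t: "t \<in> L2_cauchy M \<phi>"
  shows "L2_norm \<phi> (L2_class M \<phi> (\<lambda>n. r n - t n))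
    \<le> L2_norm \<phi> (L2_class M \<phi> (\<lambda>n. r n - s n)) + L2_norm \<phi> (L2_class M \<phi> (\<lambda>n. t n - s n))"
proof (rule LIMSEQ_le[OF tendsto_L2_norm[OF L2_cauchy_diff[OF r t]]
      tendsto_add[OF tendsto_L2_norm[OF L2_cauchy_diff[OF r s]]
        tendsto_L2_norm[OF L2_cauchy_diff[OF t s]]]])
  show "\<exists>N. \<forall>n\<ge>N. norm2 \<phi> (r n - t n) \<le> norm2 \<phi> (r n - s n) + norm2 \<phi> (t n - s n)"
    using r s t norm2_triangle norm2_minus_commute by (metis L2_cauchyD)
qed

lemma L2_norm_nonneg:
  assumes "s \<in> L2_cauchy M \<phi>"
  shows "0 \<le> L2_norm \<phi> (L2_class M \<phi> s)"
  using tendsto_L2_norm[OF assms]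
  by (rule LIMSEQ_le_const) (use assms in \<open>auto simp: norm2_nonneg L2_cauchyD\<close>)

text \<open>A late term \<open>s k\<close> of the sequence, taken as a constant sequence,
  approximates its class; the strict bound weakens to \<open>\<le>\<close> in the limit.\<close>

lemma L2_embed_dense:
  assumes s: "s \<in> L2_cauchy M \<phi>" and "0 < e"
  shows "\<exists>k. L2_norm \<phi> (L2_class M \<phi> (\<lambda>n. s n - s k)) \<le> e"
proof -
  obtain k where k: "\<And>m n. m \<ge> k \<Longrightarrow> n \<ge> k \<Longrightarrow> norm2 \<phi> (s m - s n) < e"
    using assms unfolding L2_cauchy_def by blast
  have "(\<lambda>n. s n - s k) \<in> L2_cauchy M \<phi>"
    using s by (intro L2_cauchy_diff L2_cauchy_const L2_cauchyD)
  from tendsto_L2_norm[OF this]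
  have "L2_norm \<phi> (L2_class M \<phi> (\<lambda>n. s n - s k)) \<le> e"
    by (rule LIMSEQ_le_const2) (use k in \<open>auto intro!: exI[of _ k] less_imp_le\<close>)
  then show ?thesis ..
qed

text \<open>Two continuous operators that agree on a dense set are equal. Vectors are compared
  through representing sequences, since the completion is a set of classes rather than a normed
  type.\<close>

lemma L2_bounded_operator_eqI:
  assumes S: "L2_bounded_operator M \<phi> S" and T: "L2_bounded_operator M \<phi> T"
    and eq: "\<And>X. X \<in> M \<Longrightarrow> S (L2_embed M \<phi> X) = T (L2_embed M \<phi> X)"
  shows "S = T"
proof (rule PiE_ext)
  show "S \<in> L2_space M \<phi> \<rightarrow>\<^sub>E L2_space M \<phi>" "T \<in> L2_space M \<phi> \<rightarrow>\<^sub>E L2_space M \<phi>"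
    using S T by (simp_all add: L2_bounded_operator_def)
  fix u assume u: "u \<in> L2_space M \<phi>"
  have maps: "R v \<in> L2_space M \<phi>" if "L2_bounded_operator M \<phi> R" "v \<in> L2_space M \<phi>" for R v
    using that by (auto simp: L2_bounded_operator_def)
  obtain s where s: "s \<in> L2_cauchy M \<phi>" and us: "u = L2_class M \<phi> s"
    using u by (rule L2_spaceE)
  obtain a where a: "a \<in> L2_cauchy M \<phi>" and Su: "S u = L2_class M \<phi> a"
    using maps[OF S u] by (rule L2_spaceE)
  obtain b where b: "b \<in> L2_cauchy M \<phi>" and Tu: "T u = L2_class M \<phi> b"
    using maps[OF T u] by (rule L2_spaceE)
  \<comment> \<open>By linearity, \<open>R u\<close> minus the value of \<open>R\<close> at the
    embedded \<open>s k\<close> is \<open>R\<close> applied to the class of \<open>s - s k\<close>;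
    boundedness estimates it by the distance of \<open>u\<close> from \<open>s k\<close>.\<close>
  have local_bound: "\<exists>K\<ge>0. \<forall>k d. d \<in> L2_cauchy M \<phi> \<and> R (L2_embed M \<phi> (s k)) = L2_class M \<phi> d \<longrightarrow>
      L2_norm \<phi> (L2_class M \<phi> (\<lambda>n. c n - d n)) \<le> K * L2_norm \<phi> (L2_class M \<phi> (\<lambda>n. s n - s k))"
    if R: "L2_bounded_operator M \<phi> R" and c: "c \<in> L2_cauchy M \<phi>" and Ru: "R u = L2_class M \<phi> c"
    for R c
  proof -
    obtain K where K: "\<And>v. v \<in> L2_space M \<phi> \<Longrightarrow> L2_norm \<phi> (R v) \<le> K * L2_norm \<phi> v"
      using R unfolding L2_bounded_operator_def by blast
    have "L2_norm \<phi> (L2_class M \<phi> (\<lambda>n. c n - d n))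
        \<le> max K 0 * L2_norm \<phi> (L2_class M \<phi> (\<lambda>n. s n - s k))"
      if d: "d \<in> L2_cauchy M \<phi>" and Rk: "R (L2_embed M \<phi> (s k)) = L2_class M \<phi> d" for k d
    proof -
      have k: "(\<lambda>_. s k) \<in> L2_cauchy M \<phi>"
        using s by (intro L2_cauchy_const L2_cauchyD)
      have diff: "(\<lambda>n. s n - s k) \<in> L2_cauchy M \<phi>"
        using s k by (rule L2_cauchy_diff)
      let ?v = "L2_embed M \<phi> (s k)"
      have v: "?v \<in> L2_space M \<phi>" "L2_scale M \<phi> (-1) ?v \<in> L2_space M \<phi>"
        using k by (simp_all add: L2_embed_def L2_class_in_space L2_scale_class L2_cauchy_scaleC)
      have "R (L2_class M \<phi> (\<lambda>n. s n - s k)) = R (L2_add M \<phi> u (L2_scale M \<phi> (-1) ?v))"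
        unfolding us L2_embed_def by (simp only: L2_diff_class[OF s k])
      also have "\<dots> = L2_add M \<phi> (R u) (L2_scale M \<phi> (-1) (R ?v))"
        using R u v unfolding L2_bounded_operator_def by simp
      also have "\<dots> = L2_class M \<phi> (\<lambda>n. c n - d n)"
        unfolding Ru Rk using c d by (rule L2_diff_class)
      finally have "L2_norm \<phi> (L2_class M \<phi> (\<lambda>n. c n - d n))
          \<le> K * L2_norm \<phi> (L2_class M \<phi> (\<lambda>n. s n - s k))"
        using K[OF L2_class_in_space[OF diff]] by simp
      \<comment> \<open>The constant in \<open>L2_bounded_operator\<close> carries no sign
        condition, hence the maximum with \<open>0\<close>.\<close>
      also have "\<dots> \<le> max K 0 * L2_norm \<phi> (L2_class M \<phi> (\<lambda>n. s n - s k))"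
        using L2_norm_nonneg[OF diff] by (intro mult_right_mono) auto
      finally show ?thesis .
    qed
    then show ?thesis
      by (intro exI[of _ "max K 0"]) auto
  qed
  obtain K where K: "0 \<le> K" "\<And>k d. d \<in> L2_cauchy M \<phi> \<Longrightarrow> S (L2_embed M \<phi> (s k)) = L2_class M \<phi> d \<Longrightarrow>
      L2_norm \<phi> (L2_class M \<phi> (\<lambda>n. a n - d n)) \<le> K * L2_norm \<phi> (L2_class M \<phi> (\<lambda>n. s n - s k))"
    using local_bound[OF S a Su] by blast
  obtain L where L: "0 \<le> L" "\<And>k d. d \<in> L2_cauchy M \<phi> \<Longrightarrow> T (L2_embed M \<phi> (s k)) = L2_class M \<phi> d \<Longrightarrow>
      L2_norm \<phi> (L2_class M \<phi> (\<lambda>n. b n - d n)) \<le> L * L2_norm \<phi> (L2_class M \<phi> (\<lambda>n. s n - s k))"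
    using local_bound[OF T b Tu] by blast
  have "L2_norm \<phi> (L2_class M \<phi> (\<lambda>n. a n - b n)) \<le> 0 + e" if "0 < e" for e
  proof -
    \<comment> \<open>The summand \<open>1\<close> keeps the denominator positive even if
      \<open>K\<close> and \<open>L\<close> both vanish.\<close>
    have "0 < e / (K + L + 1)"
      using K(1) L(1) that by simp
    then obtain k where k: "L2_norm \<phi> (L2_class M \<phi> (\<lambda>n. s n - s k)) \<le> e / (K + L + 1)"
      using L2_embed_dense[OF s] by blast
    have sk: "s k \<in> M"
      using s by (rule L2_cauchyD)
    then have "L2_embed M \<phi> (s k) \<in> L2_space M \<phi>"
      by (simp add: L2_embed_def L2_class_in_space L2_cauchy_const)
    \<comment> \<open>The sequence \<open>d\<close> represents the common value of \<open>S\<close>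
      and \<open>T\<close> at the embedded \<open>s k\<close>, so both \<open>a\<close> and
      \<open>b\<close> are close to it.\<close>
    then obtain d where d: "d \<in> L2_cauchy M \<phi>" and Sk: "S (L2_embed M \<phi> (s k)) = L2_class M \<phi> d"
      using maps[OF S] L2_spaceE by blast
    have "L2_norm \<phi> (L2_class M \<phi> (\<lambda>n. a n - b n))
        \<le> L2_norm \<phi> (L2_class M \<phi> (\<lambda>n. a n - d n)) + L2_norm \<phi> (L2_class M \<phi> (\<lambda>n. b n - d n))"
      using a d b by (rule L2_norm_triangle)
    also have "\<dots> \<le> (K + L) * L2_norm \<phi> (L2_class M \<phi> (\<lambda>n. s n - s k))"
      using K(2)[OF d Sk] L(2)[OF d, of k] Sk eq[OF sk] by (simp add: distrib_right)
    also have "\<dots> \<le> (K + L) * (e / (K + L + 1))"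
      using k K(1) L(1) by (intro mult_left_mono) auto
    also have "\<dots> \<le> e"
      using K(1) L(1) that by (simp add: field_simps)
    finally show ?thesis by simp
  qed
  then have "L2_norm \<phi> (L2_class M \<phi> (\<lambda>n. a n - b n)) \<le> 0"
    by (rule field_le_epsilon)
  then have "L2_norm \<phi> (L2_class M \<phi> (\<lambda>n. a n - b n)) = 0"
    using L2_norm_nonneg[OF L2_cauchy_diff[OF a b]] by simp
  then show "S u = T u"
    unfolding Su Tu by (simp only: L2_class_null_iff[OF a b])
qed

text \<open>Apply \<open>E\<close> term by term: a linear contraction maps Cauchy sequences to
  Cauchy sequences and null sequences to null sequences, so it descends to classes with the same
  bound.\<close>

lemma contraction_extends:
  assumes lin: "clinear_on M E" and maps: "\<And>X. X \<in> M \<Longrightarrow> E X \<in> M"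
    and contr: "\<And>X. X \<in> M \<Longrightarrow> norm2 \<phi> (E X) \<le> norm2 \<phi> X"
  shows "\<exists>T. L2_bounded_operator M \<phi> T \<and> L2_extends M \<phi> E T \<and> L2_opnorm M \<phi> T \<le> 1"
proof -
  have diff: "E X - E Y = E (X - Y)" if "X \<in> M" "Y \<in> M" for X Y
    using clinear_on_diff[OF lin von_neumann_algebra_csubspace[OF vna] that] by simp
  have cauchy: "(\<lambda>n. E (s n)) \<in> L2_cauchy M \<phi>" if "s \<in> L2_cauchy M \<phi>" for s
    using that by (intro L2_cauchy_contraction[where C = 1, OF that])
      (simp_all add: maps contr diff closed L2_cauchyD)
  \<comment> \<open>The union runs over copies of one class, as in \<open>L2_add\<close>;
    \<open>restrict\<close> gives the extensional form under which operators are compared.\<close>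
  define T where
    "T = restrict (\<lambda>u. \<Union>s\<in>u. L2_class M \<phi> (\<lambda>n. E (s n))) (L2_space M \<phi>)"
  have T: "T (L2_class M \<phi> s) = L2_class M \<phi> (\<lambda>n. E (s n))" if s: "s \<in> L2_cauchy M \<phi>" for s
  proof -
    have "L2_class M \<phi> (\<lambda>n. E (s' n)) = L2_class M \<phi> (\<lambda>n. E (s n))"
      if "s' \<in> L2_class M \<phi> s" for s'
    proof -
      have s': "s' \<in> L2_cauchy M \<phi>" and lim: "(\<lambda>n. norm2 \<phi> (s n - s' n)) \<longlonglongrightarrow> 0"
        using that by (auto simp: mem_L2_class L2_rel_iff)
      have "(\<lambda>n. norm2 \<phi> (E (s n) - E (s' n))) \<longlonglongrightarrow> 0"
        using s s' by (intro norm2_tendsto_0I[OF _ _ lim])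
          (simp_all add: diff contr maps closed L2_cauchyD)
      then show ?thesis
        by (metis L2_class_eq_iff cauchy s s')
    qed
    then have "(\<Union>s'\<in>L2_class M \<phi> s. L2_class M \<phi> (\<lambda>n. E (s' n))) = L2_class M \<phi> (\<lambda>n. E (s n))"
      using self_mem_L2_class[OF s] by blast
    then show ?thesis
      using L2_class_in_space[OF s] by (simp add: T_def)
  qed
  have bound: "L2_norm \<phi> (T u) \<le> L2_norm \<phi> u" if u_space: "u \<in> L2_space M \<phi>" for u
  proof -
    obtain s where s: "s \<in> L2_cauchy M \<phi>" and u: "u = L2_class M \<phi> s"
      using u_space by (rule L2_spaceE)
    show ?thesis
      unfolding u T[OF s]
      by (rule LIMSEQ_le[OF tendsto_L2_norm[OF cauchy[OF s]] tendsto_L2_norm[OF s]])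
        (use s in \<open>auto simp: contr L2_cauchyD\<close>)
  qed
  have "L2_bounded_operator M \<phi> T"
    unfolding L2_bounded_operator_def
  proof (intro conjI ballI allI)
    show "T \<in> L2_space M \<phi> \<rightarrow>\<^sub>E L2_space M \<phi>"
    proof (rule PiE_I)
      show "T u \<in> L2_space M \<phi>" if "u \<in> L2_space M \<phi>" for u
        using that by (metis L2_spaceE T cauchy L2_class_in_space)
    qed (simp add: T_def)
  next
    fix u v assume "u \<in> L2_space M \<phi>" "v \<in> L2_space M \<phi>"
    then obtain s t where st: "s \<in> L2_cauchy M \<phi>" "t \<in> L2_cauchy M \<phi>"
      "u = L2_class M \<phi> s" "v = L2_class M \<phi> t"
      by (metis L2_spaceE)
    have "(\<lambda>n. E (s n + t n)) = (\<lambda>n. E (s n) + E (t n))"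
      using lin st by (simp add: clinear_on_def L2_cauchyD)
    then show "T (L2_add M \<phi> u v) = L2_add M \<phi> (T u) (T v)"
      using st by (simp add: L2_add_class T cauchy L2_cauchy_add)
  next
    fix a u assume "u \<in> L2_space M \<phi>"
    then obtain s where s: "s \<in> L2_cauchy M \<phi>" "u = L2_class M \<phi> s"
      by (metis L2_spaceE)
    have "(\<lambda>n. E (a *\<^sub>C s n)) = (\<lambda>n. a *\<^sub>C E (s n))"
      using lin s by (simp add: clinear_on_def L2_cauchyD)
    then show "T (L2_scale M \<phi> a u) = L2_scale M \<phi> a (T u)"
      using s by (simp add: L2_scale_class T cauchy L2_cauchy_scaleC)
  next
    show "\<exists>K. \<forall>u\<in>L2_space M \<phi>. L2_norm \<phi> (T u) \<le> K * L2_norm \<phi> u"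
      using bound by (intro exI[of _ 1]) simp
  qed
  moreover have "L2_extends M \<phi> E T"
    by (simp add: L2_extends_def L2_embed_def T L2_cauchy_const)
  moreover have "L2_opnorm M \<phi> T \<le> 1"
    unfolding L2_opnorm_def
  proof (rule cSUP_least)
    \<comment> \<open>The zero class shows that the supremum in \<open>L2_opnorm\<close> is over a
      nonempty set.\<close>
    have "L2_norm \<phi> (L2_class M \<phi> (\<lambda>_. 0)) = 0"
      using tendsto_L2_norm[OF L2_cauchy_const[OF zero_closed]]
      by (simp add: LIMSEQ_const_iff)
    then show "{u \<in> L2_space M \<phi>. L2_norm \<phi> u \<le> 1} \<noteq> {}"
      using L2_class_in_space[OF L2_cauchy_const[OF zero_closed]]
      by (metis (mono_tags, lifting) empty_iff mem_Collect_eq zero_le_one)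
  qed (use bound in fastforce)
  ultimately show ?thesis by blast
qed

section \<open>The conditional expectation as an orthogonal projection\<close>

lemma conditional_expectation_state_inner:
  assumes N: "von_neumann_algebra N"
    and E: "conditional_expectation M N E" and pres: "state_preserving M \<phi> E"
    and X: "X \<in> M" and A: "A \<in> N" "A \<in> M"
  shows "state_inner \<phi> (E X) A = state_inner \<phi> X A"
proof -
  have cp: "completely_positive_on M E"
    and bimod: "\<And>a b Y. a \<in> N \<Longrightarrow> b \<in> N \<Longrightarrow> Y \<in> M \<Longrightarrow> E (a * Y * b) = a * E Y * b"
    using E by (auto simp: conditional_expectation_def)
  have "adj (E X) = E (adj X)"
    using X by (intro adj_eqI completely_positive_on_adjoint[OF vna cp] is_adjoint_adj adj_closed)
  then have "state_inner \<phi> (E X) A = \<phi> (E (adj X) * A)"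
    by (simp add: state_inner_def)
  \<comment> \<open>Bimodularity with left factor \<open>1\<close> and right factor \<open>A\<close>
    moves \<open>A\<close> inside \<open>E\<close>.\<close>
  also have "\<dots> = \<phi> (E (adj X * A))"
    using bimod[OF von_neumann_algebra_one[OF N] A(1) adj_closed[OF X]] by simp
  also have "\<dots> = state_inner \<phi> X A"
    using pres X A by (simp add: state_preserving_def state_inner_def closed)
  finally show ?thesis .
qed

text \<open>Cauchy-Schwarz bounds the square of \<open>norm2 \<phi> Y\<close> by the product of both
  seminorms, and one factor cancels. If that factor is zero, the claim is nonnegativity of
  \<open>norm2 \<phi> X\<close>.\<close>

lemma norm2_contraction_of_projection:
  assumes X: "X \<in> M" and Y: "Y \<in> M" and eq: "state_inner \<phi> Y Y = state_inner \<phi> X Y"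
  shows "norm2 \<phi> Y \<le> norm2 \<phi> X"
proof -
  have "(norm2 \<phi> Y)\<^sup>2 = norm (state_inner \<phi> Y Y)"
    using Y by (simp add: state_inner_self norm_power)
  also have "\<dots> \<le> norm2 \<phi> X * norm2 \<phi> Y"
    unfolding eq using X Y by (rule state_inner_Cauchy_Schwarz)
  finally have "norm2 \<phi> Y * norm2 \<phi> Y \<le> norm2 \<phi> X * norm2 \<phi> Y"
    by (simp add: power2_eq_square)
  then show ?thesis
    using norm2_nonneg[OF X] norm2_nonneg[OF Y] by (auto simp: mult_le_cancel_right)
qed

end

theorem proposition4p3:
  fixes M N :: "'h::chilbert_space bop set"
    and \<phi> :: "'h bop \<Rightarrow> complex"
    and E :: "'h bop \<Rightarrow> 'h bop"
  assumes "von_neumann_algebra M"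
    and "faithful_normal_state M \<phi>"
    and "von_neumann_subalgebra N M"
    and "abelian N"
    and "conditional_expectation M N E"
    and "normal_map M N E"
    and "state_preserving M \<phi> E"
  shows "(\<forall>X\<in>M. norm2 \<phi> (E X) \<le> norm2 \<phi> X \<and>
            (\<forall>A\<in>N. state_inner \<phi> (E X) A = state_inner \<phi> X A)) \<and>
         (\<exists>T. L2_bounded_operator M \<phi> T \<and> L2_extends M \<phi> E T \<and> L2_opnorm M \<phi> T \<le> 1 \<and>
            (\<forall>S. L2_bounded_operator M \<phi> S \<and> L2_extends M \<phi> E S \<longrightarrow> S = T))"
proof -
  interpret state_form M \<phi>
    using assms(1,2) by unfold_locales (simp_all add: faithful_normal_state_def)
  have N: "von_neumann_algebra N" "N \<subseteq> M"
    using assms(3) by (simp_all add: von_neumann_subalgebra_def)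
  have E_N: "E X \<in> N" if "X \<in> M" for X
    using assms(5) that by (auto simp: conditional_expectation_def)
  have lin: "clinear_on M E"
    using assms(5) by (simp add: conditional_expectation_def completely_positive_on_def)
  have proj: "state_inner \<phi> (E X) A = state_inner \<phi> X A" if "X \<in> M" "A \<in> N" for X A
    using conditional_expectation_state_inner[OF N(1) assms(5,7)] that N(2) by blast
  \<comment> \<open>Here the projection identity is used with \<open>A = E X\<close>, which lies in
    \<open>N\<close>.\<close>
  have contr: "norm2 \<phi> (E X) \<le> norm2 \<phi> X" if "X \<in> M" for X
    using that E_N[OF that] N(2) by (intro norm2_contraction_of_projection proj) auto
  obtain T where T: "L2_bounded_operator M \<phi> T" "L2_extends M \<phi> E T" "L2_opnorm M \<phi> T \<le> 1"
    using contraction_extends[OF lin _ contr] E_N N(2) by blast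
  \<comment> \<open>Both operators take the embedded \<open>X\<close> to the embedded
    \<open>E X\<close>, so they agree on a dense set.\<close>
  have "S = T" if "L2_bounded_operator M \<phi> S" "L2_extends M \<phi> E S" for S
    using that T by (intro L2_bounded_operator_eqI) (simp_all add: L2_extends_def)
  with T proj contr show ?thesis
    by blast
qed

end
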